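(* Let $\varepsilon, \delta \in (0,1)$ and $\gamma > 1$. Let $X_1, X_2, \ldots$ be a sequence of i.i.d. random variables on a probability space $(\Omega, \mathscr{F}, \Pr)$ such that $0 \le X_i \le 1$ and $\mathbb{E}[X_i] = \mu \in (0,1)$ for every positive integer $i$. Let $\boldsymbol{n}$ be the random variable $\boldsymbol{n}(\omega) = \min\{ n \in \mathbb{Z} : \sum_{i=1}^n X_i(\omega) \ge \gamma \}$, and define $\widetilde{\boldsymbol{\mu}} = \frac{\gamma}{\boldsymbol{n}}$ and $\widehat{\boldsymbol{\mu}} = \frac{\gamma-1}{\boldsymbol{n}-1}$. Then $$\Pr\left\{ \left| \frac{\widetilde{\boldsymbol{\mu}} - \mu}{\mu} \right| < \varepsilon \right\} > 1 - \delta \quad\text{and}\quad \Pr\left\{ \left| \frac{\widehat{\boldsymbol{\mu}} - \mu}{\mu} \right| < \varepsilon \right\} > 1 - \delta$$ provided that $$\gamma > \frac{(1+\varepsilon)\ln\frac{2}{\delta}}{(1+\varepsilon)\ln(1+\varepsilon) - \varepsilon}.$$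
   Context: Sampling stops at the first sample size $\boldsymbol{n}$ for which the sample sum is at least $\gamma$. $\ln$ is the natural logarithm. *)

theory Defs
  imports "HOL-Probability.Probability"
begin

text \<open>
  The sequence is indexed by the positive integers, so \<open>X 0\<close> is never used.
\<close>

definition iid_sequence :: "'a measure \<Rightarrow> (nat \<Rightarrow> 'a \<Rightarrow> real) \<Rightarrow> bool" where
  "iid_sequence M X \<longleftrightarrow>
     prob_space.indep_vars M (\<lambda>_. borel) X {1..} \<and>
     (\<forall>i\<ge>1. \<forall>j\<ge>1. distr M borel (X i) = distr M borel (X j))"

text \<open>
  Indices \<open>n \<le> 0\<close> give the empty sum \<open>0\<close>, which is below every positive
  threshold, so for \<open>\<gamma> > 0\<close> the minimum over the integers is the one over the
  naturals.  On outcomes where the partial sums never reach \<open>\<gamma>\<close> the minimum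
  does not exist and \<open>LEAST\<close> returns an unspecified fixed number; for an i.i.d.
  sequence with values in \<open>[0, 1]\<close> and positive mean these outcomes form a null set.
\<close>

definition stopping_index :: "(nat \<Rightarrow> 'a \<Rightarrow> real) \<Rightarrow> real \<Rightarrow> 'a \<Rightarrow> nat" where
  "stopping_index X \<gamma> \<omega> = (LEAST n. (\<Sum>i=1..n. X i \<omega>) \<ge> \<gamma>)"

definition mu_tilde :: "(nat \<Rightarrow> 'a \<Rightarrow> real) \<Rightarrow> real \<Rightarrow> 'a \<Rightarrow> real" where
  "mu_tilde X \<gamma> \<omega> = \<gamma> / real (stopping_index X \<gamma> \<omega>)"

definition mu_hat :: "(nat \<Rightarrow> 'a \<Rightarrow> real) \<Rightarrow> real \<Rightarrow> 'a \<Rightarrow> real" where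
  "mu_hat X \<gamma> \<omega> = (\<gamma> - 1) / (real (stopping_index X \<gamma> \<omega>) - 1)"

end

theory Submission
  imports Defs
begin

text \<open>
  If \<open>S n\<close> is the \<open>n\<close>-th partial sum, then \<open>S N < \<gamma> \<le> S k\<close> forces
  \<open>N < \<^bold>n \<le> k\<close>, so it suffices to choose \<open>N\<close> and \<open>k\<close> as the extreme sample sizes compatible
  with relative error below \<open>\<epsilon>\<close> and to bound \<open>Pr {S N \<ge> \<gamma>}\<close> and \<open>Pr {S k < \<gamma>}\<close> by Chernoff.
  For both estimators either \<open>\<mu> N \<le> \<gamma> / (1 + \<epsilon>)\<close> or \<open>N < \<gamma>\<close> (in which case
  \<open>S N \<ge> \<gamma>\<close> is impossible), and the upper tail at exponent \<open>ln (1 + \<epsilon>)\<close> is at most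
  \<open>exp (- \<gamma> g)\<close> with \<open>g = ln (1 + \<epsilon>) - \<epsilon> / (1 + \<epsilon>)\<close>; this is below \<open>\<delta> / 2\<close> by the
  hypothesis on \<open>\<gamma>\<close>.  Since \<open>g \<le> \<epsilon>\<^sup>2 / 2\<close>, that hypothesis also gives \<open>\<gamma> \<epsilon>\<^sup>2 \<ge> 1\<close>, whence
  \<open>(\<gamma> - 1) / (1 - \<epsilon>) \<ge> \<gamma> (1 + \<epsilon>)\<close> and \<open>\<mu> k \<ge> \<gamma> (1 + \<epsilon>)\<close>.  The lower tail at
  exponent \<open>- ln (1 + \<epsilon>)\<close> is therefore at most \<open>exp (\<gamma> (ln (1 + \<epsilon>) - \<epsilon>))\<close>, which is again at
  most \<open>exp (- \<gamma> g)\<close>.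
\<close>

section \<open>Elementary inequalities for \<open>ln\<close> and \<open>exp\<close>\<close>

text \<open>The difference of the two sides vanishes at 0 and has derivative
  \<open>(y / (1 + y))\<^sup>2\<close>. It serves to bound \<open>g\<close> from above and to
  compare the two tails.\<close>

lemma two_ln_one_plus_le:
  fixes x :: real
  assumes "0 \<le> x"
  shows "2 * ln (1 + x) \<le> x + x / (1 + x)"
proof -
  define f where "f = (\<lambda>x::real. x + x / (1 + x) - 2 * ln (1 + x))"
  have "f 0 \<le> f x"
  proof (rule DERIV_nonneg_imp_nondecreasing[OF assms])
    fix y :: real
    assume y: "0 \<le> y" "y \<le> x"
    have "(f has_real_derivative 1 + (1 * (1 + y) - y * 1) / ((1 + y) * (1 + y)) - 2 * (1 / (1 + y))) (at y)"
      unfolding f_def using y by (auto intro!: derivative_eq_intros)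
    also have "1 + (1 * (1 + y) - y * 1) / ((1 + y) * (1 + y)) - 2 * (1 / (1 + y)) = (y / (1 + y))\<^sup>2"
    proof -
      have "1 + y \<noteq> 0"
        using y by simp
      then show ?thesis
        by (simp add: divide_simps power2_eq_square) (simp add: algebra_simps)
    qed
    finally have "(f has_real_derivative (y / (1 + y))\<^sup>2) (at y)" .
    then show "\<exists>D. (f has_real_derivative D) (at y) \<and> 0 \<le> D"
      by (intro exI[of _ "(y / (1 + y))\<^sup>2"]) simp
  qed
  then show ?thesis
    by (simp add: f_def)
qed

text \<open>Instance \<open>z = 1 / (1 + x)\<close> of \<open>ln z \<le> z - 1\<close>, where
  equality holds only at \<open>z = 1\<close>. It makes \<open>g\<close> positive.\<close>

lemma ln_one_plus_gt:
  fixes x :: real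
  assumes "0 < x"
  shows "x / (1 + x) < ln (1 + x)"
proof -
  have "ln (1 / (1 + x)) \<noteq> 1 / (1 + x) - 1"
    using ln_eq_minus_one[of "1 / (1 + x)"] assms by auto
  moreover have "ln (1 / (1 + x)) \<le> 1 / (1 + x) - 1"
    using assms by (intro ln_le_minus_one) auto
  moreover have "1 / (1 + x) - 1 = - (x / (1 + x))"
    using assms by (simp add: field_simps)
  ultimately show ?thesis
    using assms by (simp add: ln_div)
qed

text \<open>Convexity of \<open>exp\<close> between 0 and \<open>t\<close>. In the mean, the right
  side is the moment generating function of a Bernoulli variable.\<close>

lemma exp_mult_le_chord:
  fixes t x :: real
  assumes "0 \<le> x" "x \<le> 1"
  shows "exp (t * x) \<le> 1 + x * (exp t - 1)"
  using convex_onD[OF exp_convex, of x 0 t] assms by (simp add: algebra_simps)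

section \<open>Exponential tail bound for sums\<close>

text \<open>Covers both tails: positive \<open>t\<close> gives the upper one, negative
  \<open>t\<close> the lower one. Each factor is bounded by the chord and then by
  \<open>1 + u \<le> exp u\<close>.\<close>

lemma (in prob_space) Chernoff_unit_interval:
  fixes X :: "'i \<Rightarrow> 'a \<Rightarrow> real"
  assumes fin: "finite I" and indep: "indep_vars (\<lambda>_. borel) X I"
    and bounds: "\<And>i \<omega>. i \<in> I \<Longrightarrow> \<omega> \<in> space M \<Longrightarrow> 0 \<le> X i \<omega> \<and> X i \<omega> \<le> 1"
    and mean: "\<And>i. i \<in> I \<Longrightarrow> expectation (X i) = \<mu>"
  shows "prob {\<omega> \<in> space M. t * (\<Sum>i\<in>I. X i \<omega>) \<ge> t * a}
           \<le> exp (real (card I) * \<mu> * (exp t - 1) - t * a)"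
proof -
  have meas [measurable]: "X i \<in> borel_measurable M" if "i \<in> I" for i
    using indep that by (simp add: indep_vars_def)
  have int_X: "integrable M (X i)" if "i \<in> I" for i
    using that bounds by (intro integrable_const_bound[where B = 1]) auto
  have int_exp: "integrable M (\<lambda>\<omega>. exp (t * X i \<omega>))" if "i \<in> I" for i
  proof (rule Bochner_Integration.integrable_bound)
    show "integrable M (\<lambda>\<omega>. 1 + X i \<omega> * (exp t - 1))"
      using int_X[OF that] by simp
    show "AE \<omega> in M. norm (exp (t * X i \<omega>)) \<le> norm (1 + X i \<omega> * (exp t - 1))"
    proof (rule AE_I2)
      fix \<omega> assume "\<omega> \<in> space M"
      then have "exp (t * X i \<omega>) \<le> 1 + X i \<omega> * (exp t - 1)"
        using bounds that by (intro exp_mult_le_chord) auto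
      then show "norm (exp (t * X i \<omega>)) \<le> norm (1 + X i \<omega> * (exp t - 1))"
        by simp
    qed
  qed (use that in measurable)
  have mgf: "expectation (\<lambda>\<omega>. exp (t * X i \<omega>)) \<le> exp (\<mu> * (exp t - 1))" if "i \<in> I" for i
  proof -
    have "expectation (\<lambda>\<omega>. exp (t * X i \<omega>)) \<le> expectation (\<lambda>\<omega>. 1 + X i \<omega> * (exp t - 1))"
      using int_exp[OF that] int_X[OF that] bounds that
      by (intro integral_mono) (auto intro!: exp_mult_le_chord)
    also have "\<dots> = 1 + \<mu> * (exp t - 1)"
      using int_X[OF that] mean[OF that] by (simp add: prob_space)
    also have "\<dots> \<le> exp (\<mu> * (exp t - 1))"
      by (rule exp_ge_add_one_self)
    finally show ?thesis .
  qed
  have indep_exp: "indep_vars (\<lambda>_. borel) (\<lambda>i \<omega>. exp (t * X i \<omega>)) I"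
    by (rule indep_vars_compose2[OF indep]) simp
  have exp_sum_eq: "exp (t * (\<Sum>i\<in>I. X i \<omega>)) = (\<Prod>i\<in>I. exp (t * X i \<omega>))" for \<omega>
    using fin by (simp add: sum_distrib_left exp_sum)
  have int_prod: "integrable M (\<lambda>\<omega>. exp (t * (\<Sum>i\<in>I. X i \<omega>)))"
    unfolding exp_sum_eq by (rule indep_vars_integrable[OF fin indep_exp int_exp])
  \<comment> \<open>The Chernoff parameter is 1 and \<open>t\<close> is absorbed into the variable,
    so the sign of \<open>t\<close> stays free.\<close>
  have "prob {\<omega> \<in> space M. t * (\<Sum>i\<in>I. X i \<omega>) \<ge> t * a}
          \<le> exp (- 1 * (t * a)) * (\<integral>\<omega>\<in>space M. exp (1 * (t * (\<Sum>i\<in>I. X i \<omega>))) \<partial>M)"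
    using int_prod unfolding set_integrable_def
    by (intro Chernoff_ineq_ge) (auto simp only: set_integrable_def mult_1 intro!: integrable_mult_indicator)
  also have "\<dots> = exp (- (t * a)) * (\<Prod>i\<in>I. expectation (\<lambda>\<omega>. exp (t * X i \<omega>)))"
    using int_prod indep_vars_lebesgue_integral[OF fin indep_exp int_exp]
    by (simp add: set_integral_space exp_sum_eq)
  also have "\<dots> \<le> exp (- (t * a)) * (\<Prod>i\<in>I. exp (\<mu> * (exp t - 1)))"
    using mgf by (intro mult_left_mono prod_mono) auto
  also have "\<dots> = exp (real (card I) * \<mu> * (exp t - 1) - t * a)"
    by (simp add: exp_of_nat_mult[symmetric] mult_exp_exp mult.assoc)
  finally show ?thesis .
qed

section \<open>Confining the stopping index to a window\<close>

text \<open>Partial sums are monotone, and reaching \<open>\<gamma>\<close> at \<open>k\<close>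
  ensures that \<open>LEAST\<close> is attained.\<close>

lemma stopping_index_window:
  assumes "\<And>i. i \<ge> 1 \<Longrightarrow> 0 \<le> X i \<omega>"
    and "(\<Sum>i=1..N. X i \<omega>) < \<gamma>" and "\<gamma> \<le> (\<Sum>i=1..k. X i \<omega>)"
  shows "N < stopping_index X \<gamma> \<omega>" and "stopping_index X \<gamma> \<omega> \<le> k"
proof -
  let ?n = "stopping_index X \<gamma> \<omega>"
  show "?n \<le> k"
    unfolding stopping_index_def using assms(3) by (rule Least_le)
  have "\<gamma> \<le> (\<Sum>i=1..?n. X i \<omega>)"
    unfolding stopping_index_def using assms(3) by (rule LeastI)
  with assms(2) have "(\<Sum>i=1..N. X i \<omega>) < (\<Sum>i=1..?n. X i \<omega>)"
    by linarith
  moreover have "(\<Sum>i=1..?n. X i \<omega>) \<le> (\<Sum>i=1..N. X i \<omega>)" if "?n \<le> N"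
    using that assms(1) by (intro sum_mono2) auto
  ultimately show "N < ?n"
    by force
qed

lemma sample_size_threshold:
  fixes \<epsilon> \<delta> \<gamma> :: real
  assumes "0 < \<epsilon>" "0 < \<delta>" "\<delta> < 1"
    and \<gamma>: "\<gamma> > (1 + \<epsilon>) * ln (2 / \<delta>) / ((1 + \<epsilon>) * ln (1 + \<epsilon>) - \<epsilon>)"
  shows "exp (- \<gamma> * (ln (1 + \<epsilon>) - \<epsilon> / (1 + \<epsilon>))) < \<delta> / 2"
    and "1 < \<gamma> * \<epsilon>\<^sup>2"
proof -
  define g where "g = ln (1 + \<epsilon>) - \<epsilon> / (1 + \<epsilon>)"
  have g_pos: "0 < g"
    using ln_one_plus_gt[of \<epsilon>] assms by (simp add: g_def)
  \<comment> \<open>The factor \<open>1 + \<epsilon>\<close> cancels, so the hypothesis reads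
    \<open>ln (2 / \<delta>) < \<gamma> * g\<close>.\<close>
  have "(1 + \<epsilon>) * ln (1 + \<epsilon>) - \<epsilon> = (1 + \<epsilon>) * g"
    using assms(1) by (simp add: g_def field_simps)
  with \<gamma> assms(1) have "\<gamma> > ln (2 / \<delta>) / g"
    by simp
  with g_pos have ln_less: "ln (2 / \<delta>) < \<gamma> * g"
    by (simp add: field_simps)
  then have "exp (- (\<gamma> * g)) < exp (- ln (2 / \<delta>))"
    by simp
  also have "\<dots> = \<delta> / 2"
    using assms by (simp add: exp_minus)
  finally show "exp (- \<gamma> * (ln (1 + \<epsilon>) - \<epsilon> / (1 + \<epsilon>))) < \<delta> / 2"
    by (simp add: g_def)
  have "g \<le> (\<epsilon> - \<epsilon> / (1 + \<epsilon>)) / 2"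
    using two_ln_one_plus_le[OF less_imp_le[OF assms(1)]]
    unfolding g_def by (simp only: le_divide_eq_numeral1 left_diff_distrib)
  also have "\<epsilon> - \<epsilon> / (1 + \<epsilon>) = \<epsilon>\<^sup>2 / (1 + \<epsilon>)"
    using assms(1) by (simp add: field_simps power2_eq_square)
  also have "\<dots> \<le> \<epsilon>\<^sup>2"
    using assms(1) by (simp add: divide_le_eq mult_le_cancel_left1)
  finally have g_le: "g \<le> \<epsilon>\<^sup>2 / 2"
    by simp
  \<comment> \<open>Any lower bound of at least 1/2 would do, since
    \<open>2 * \<gamma> * g \<le> \<gamma> * \<epsilon>\<^sup>2\<close>.\<close>
  have "2 / 3 \<le> ln (2::real)"
    by (rule ln2_ge_two_thirds)
  also have "\<dots> \<le> ln (2 / \<delta>)"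
    using assms by (simp add: field_simps)
  finally have *: "2 / 3 < \<gamma> * g"
    using ln_less by simp
  then have "0 < \<gamma> * g"
    by linarith
  then have "0 < \<gamma>"
    using g_pos by (rule zero_less_mult_pos2)
  with g_le have "\<gamma> * g \<le> \<gamma> * (\<epsilon>\<^sup>2 / 2)"
    by (intro mult_left_mono) auto
  with * show "1 < \<gamma> * \<epsilon>\<^sup>2"
    by simp
qed

text \<open>Each of the two bad events costs less than \<open>\<delta> / 2\<close>. The predicate
  \<open>P\<close> is left abstract so that both estimators can use the result.\<close>

lemma (in prob_space) prob_stopping_index_window:
  fixes X :: "nat \<Rightarrow> 'a \<Rightarrow> real"
  assumes indep: "indep_vars (\<lambda>_. borel) X {1..}"
    and bounds: "\<And>i \<omega>. i \<ge> 1 \<Longrightarrow> \<omega> \<in> space M \<Longrightarrow> 0 \<le> X i \<omega> \<and> X i \<omega> \<le> 1"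
    and mean: "\<And>i. i \<ge> 1 \<Longrightarrow> expectation (X i) = \<mu>"
    and "0 < \<epsilon>" "0 < \<gamma>" "0 < \<delta>"
    and tail: "exp (- \<gamma> * (ln (1 + \<epsilon>) - \<epsilon> / (1 + \<epsilon>))) < \<delta> / 2"
    and N: "real N * \<mu> \<le> \<gamma> / (1 + \<epsilon>) \<or> real N < \<gamma>"
    and k: "\<gamma> * (1 + \<epsilon>) \<le> real k * \<mu>"
    and P: "\<And>n. N < n \<Longrightarrow> n \<le> k \<Longrightarrow> P n"
  shows "prob {\<omega> \<in> space M. P (stopping_index X \<gamma> \<omega>)} > 1 - \<delta>"
proof -
  define S where "S = (\<lambda>n \<omega>. \<Sum>i=1..n. X i \<omega>)"
  have meas_X [measurable]: "X i \<in> borel_measurable M" if "i \<ge> 1" for i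
    using indep that by (simp add: indep_vars_def)
  have meas_S [measurable]: "S n \<in> borel_measurable M" for n
    unfolding S_def by (intro borel_measurable_sum) auto
  have Chernoff: "prob {\<omega> \<in> space M. t * S n \<omega> \<ge> t * \<gamma>}
      \<le> exp (real n * \<mu> * (exp t - 1) - t * \<gamma>)" for n t
    using Chernoff_unit_interval[of "{1..n}" X \<mu> t \<gamma>] indep_vars_subset[OF indep, of "{1..n}"]
      bounds mean by (auto simp: S_def)
  define L where "L = ln (1 + \<epsilon>)"
  have L: "0 < L" "exp L = 1 + \<epsilon>"
    using \<open>0 < \<epsilon>\<close> by (simp_all add: L_def)
  let ?up = "{\<omega> \<in> space M. \<gamma> \<le> S N \<omega>}" and ?low = "{\<omega> \<in> space M. S k \<omega> < \<gamma>}"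
  have up: "prob ?up < \<delta> / 2"
    using N
  proof
    assume N: "real N * \<mu> \<le> \<gamma> / (1 + \<epsilon>)"
    have "prob ?up \<le> exp (real N * \<mu> * \<epsilon> - L * \<gamma>)"
      using Chernoff[of L N] L by simp
    also have "\<dots> \<le> exp (\<gamma> / (1 + \<epsilon>) * \<epsilon> - L * \<gamma>)"
      using mult_right_mono[OF N, of \<epsilon>] \<open>0 < \<epsilon>\<close> by simp
    also have "\<dots> = exp (- \<gamma> * (ln (1 + \<epsilon>) - \<epsilon> / (1 + \<epsilon>)))"
      by (simp add: L_def algebra_simps)
    also note tail
    finally show ?thesis .
  next
    assume N: "real N < \<gamma>"
    have "S N \<omega> \<le> real N" if "\<omega> \<in> space M" for \<omega>
      unfolding S_def using sum_bounded_above[of "{1..N}" "\<lambda>i. X i \<omega>" 1] bounds that by simp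
    then have empty: "?up = {}"
      using N by force
    show ?thesis
      unfolding empty using \<open>0 < \<delta>\<close> by simp
  qed
  \<comment> \<open>Multiplying by \<open>- L\<close> turns the lower tail into the form of the
    Chernoff bound, where \<open>exp (- L) - 1 = - \<epsilon> / (1 + \<epsilon>)\<close>.\<close>
  have "prob ?low \<le> prob {\<omega> \<in> space M. (- L) * S k \<omega> \<ge> (- L) * \<gamma>}"
    using L by (intro finite_measure_mono) auto
  also have "\<dots> \<le> exp (real k * \<mu> * (exp (- L) - 1) - (- L) * \<gamma>)"
    by (rule Chernoff)
  also have "\<dots> = exp (L * \<gamma> - real k * \<mu> * (\<epsilon> / (1 + \<epsilon>)))"
    using \<open>0 < \<epsilon>\<close> by (simp add: exp_minus L field_simps)
  also have "\<dots> \<le> exp (L * \<gamma> - \<gamma> * (1 + \<epsilon>) * (\<epsilon> / (1 + \<epsilon>)))"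
    using mult_right_mono[OF k, of "\<epsilon> / (1 + \<epsilon>)"] \<open>0 < \<epsilon>\<close> by simp
  \<comment> \<open>The exponent on the left is \<open>\<gamma> * (L - \<epsilon>)\<close>, and
    \<open>L - \<epsilon> \<le> \<epsilon> / (1 + \<epsilon>) - L\<close> is
    \<open>two_ln_one_plus_le\<close>.\<close>
  also have "\<dots> \<le> exp (- \<gamma> * (ln (1 + \<epsilon>) - \<epsilon> / (1 + \<epsilon>)))"
  proof -
    have "\<gamma> * (2 * L) \<le> \<gamma> * (\<epsilon> + \<epsilon> / (1 + \<epsilon>))"
      unfolding L_def using two_ln_one_plus_le[of \<epsilon>] \<open>0 < \<epsilon>\<close> \<open>0 < \<gamma>\<close>
      by (intro mult_left_mono) auto
    moreover have "\<gamma> * (1 + \<epsilon>) * (\<epsilon> / (1 + \<epsilon>)) = \<gamma> * \<epsilon>"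
      using \<open>0 < \<epsilon>\<close> by simp
    ultimately show ?thesis
      unfolding L_def[symmetric] by (simp add: algebra_simps)
  qed
  also note tail
  finally have low: "prob ?low < \<delta> / 2" .
  have [measurable]: "stopping_index X \<gamma> \<in> measurable M (count_space UNIV)"
    unfolding stopping_index_def S_def[symmetric] by (intro measurable_Least) (simp add: S_def[symmetric])
  have good: "{\<omega> \<in> space M. P (stopping_index X \<gamma> \<omega>)} \<in> events"
    by measurable
  have "space M - (?up \<union> ?low) \<subseteq> {\<omega> \<in> space M. P (stopping_index X \<gamma> \<omega>)}"
  proof
    fix \<omega> assume \<omega>: "\<omega> \<in> space M - (?up \<union> ?low)"
    then have "N < stopping_index X \<gamma> \<omega>" "stopping_index X \<gamma> \<omega> \<le> k"
      using bounds stopping_index_window[of X \<omega> N \<gamma> k] by (auto simp: S_def not_le not_less)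
    with \<omega> show "\<omega> \<in> {\<omega> \<in> space M. P (stopping_index X \<gamma> \<omega>)}"
      using P by auto
  qed
  with good have "prob (space M - (?up \<union> ?low)) \<le> prob {\<omega> \<in> space M. P (stopping_index X \<gamma> \<omega>)}"
    by (intro finite_measure_mono)
  moreover have "prob (space M - (?up \<union> ?low)) = 1 - prob (?up \<union> ?low)"
    by (intro prob_compl) measurable
  moreover have "prob (?up \<union> ?low) \<le> prob ?up + prob ?low"
    by (rule measure_Un_le; measurable)
  ultimately show ?thesis
    using up low by linarith
qed

section \<open>Windows for the two estimators\<close>

lemma relative_error_less_iff:
  fixes a b \<mu> \<epsilon> :: real
  assumes "0 < \<mu>" "0 < b" "0 < \<epsilon>" "\<epsilon> < 1"
  shows "\<bar>(a / b - \<mu>) / \<mu>\<bar> < \<epsilon> \<longleftrightarrow> a / ((1 + \<epsilon>) * \<mu>) < b \<and> b < a / ((1 - \<epsilon>) * \<mu>)"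
proof -
  have "\<bar>(a / b - \<mu>) / \<mu>\<bar> < \<epsilon> \<longleftrightarrow> \<bar>a / b - \<mu>\<bar> < \<epsilon> * \<mu>"
    using assms(1) by (simp add: abs_divide divide_less_eq)
  also have "\<dots> \<longleftrightarrow> (1 - \<epsilon>) * \<mu> < a / b \<and> a / b < (1 + \<epsilon>) * \<mu>"
    by (auto simp: abs_less_iff algebra_simps)
  also have "\<dots> \<longleftrightarrow> a / ((1 + \<epsilon>) * \<mu>) < b \<and> b < a / ((1 - \<epsilon>) * \<mu>)"
    using assms by (auto simp: less_divide_eq divide_less_eq mult.commute mult.left_commute)
  finally show ?thesis .
qed

theorem corollary1:
  fixes M :: "'a measure" and X :: "nat \<Rightarrow> 'a \<Rightarrow> real"
    and \<epsilon> \<delta> \<gamma> \<mu> :: real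
  assumes "prob_space M"
    and "0 < \<epsilon>" "\<epsilon> < 1"
    and "0 < \<delta>" "\<delta> < 1"
    and "\<gamma> > 1"
    and "0 < \<mu>" "\<mu> < 1"
    and "iid_sequence M X"
    and "\<And>i \<omega>. i \<ge> 1 \<Longrightarrow> \<omega> \<in> space M \<Longrightarrow> 0 \<le> X i \<omega> \<and> X i \<omega> \<le> 1"
    and "\<And>i. i \<ge> 1 \<Longrightarrow> prob_space.expectation M (X i) = \<mu>"
    and "\<gamma> > (1 + \<epsilon>) * ln (2 / \<delta>) / ((1 + \<epsilon>) * ln (1 + \<epsilon>) - \<epsilon>)"
  shows "measure M {\<omega> \<in> space M. \<bar>(mu_tilde X \<gamma> \<omega> - \<mu>) / \<mu>\<bar> < \<epsilon>} > 1 - \<delta> \<and>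
         measure M {\<omega> \<in> space M. \<bar>(mu_hat X \<gamma> \<omega> - \<mu>) / \<mu>\<bar> < \<epsilon>} > 1 - \<delta>"
proof -
  interpret prob_space M by fact
  have indep: "indep_vars (\<lambda>_. borel) X {1..}"
    using assms by (simp add: iid_sequence_def)
  note threshold = sample_size_threshold[OF \<open>0 < \<epsilon>\<close> \<open>0 < \<delta>\<close> \<open>\<delta> < 1\<close> assms(12)]
  have "0 < \<gamma>"
    using \<open>\<gamma> > 1\<close> by simp
  have window: "prob {\<omega> \<in> space M. P (stopping_index X \<gamma> \<omega>)} > 1 - \<delta>"
    if "real N * \<mu> \<le> \<gamma> / (1 + \<epsilon>) \<or> real N < \<gamma>" "\<gamma> * (1 + \<epsilon>) \<le> real k * \<mu>"
      "\<And>n. N < n \<Longrightarrow> n \<le> k \<Longrightarrow> P n" for N k P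
  proof (rule prob_stopping_index_window[OF indep])
    show "0 \<le> X i \<omega> \<and> X i \<omega> \<le> 1" if "i \<ge> 1" "\<omega> \<in> space M" for i \<omega>
      by (rule assms(10)[OF that])
    show "expectation (X i) = \<mu>" if "i \<ge> 1" for i
      by (rule assms(11)[OF that])
  qed (fact \<open>0 < \<epsilon>\<close> \<open>0 < \<gamma>\<close> \<open>0 < \<delta>\<close> threshold(1) that)+
  have pos: "0 < (1 + \<epsilon>) * \<mu>" "0 < (1 - \<epsilon>) * \<mu>" "0 < 1 - \<epsilon>"
    using assms by simp_all
  \<comment> \<open>Multiplied by \<open>1 - \<epsilon>\<close>, this is
    \<open>1 \<le> \<gamma> * \<epsilon>\<^sup>2\<close>.\<close>
  have gap: "\<gamma> * (1 + \<epsilon>) \<le> (\<gamma> - 1) / (1 - \<epsilon>)"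
    using threshold(2) pos(3) by (simp add: le_divide_eq power2_eq_square algebra_simps)

  have tilde: "measure M {\<omega> \<in> space M. \<bar>(\<gamma> / real (stopping_index X \<gamma> \<omega>) - \<mu>) / \<mu>\<bar> < \<epsilon>} > 1 - \<delta>"
  proof (rule window)
    define A where "A = \<gamma> / ((1 + \<epsilon>) * \<mu>)"
    define B where "B = \<gamma> / ((1 - \<epsilon>) * \<mu>)"
    have A: "0 < A" "A * \<mu> = \<gamma> / (1 + \<epsilon>)" and B: "0 < B" "B * \<mu> = \<gamma> / (1 - \<epsilon>)"
      using assms pos by (simp_all add: A_def B_def)
    \<comment> \<open>The largest integer strictly below \<open>B\<close>, as the error bound is
      strict.\<close>
    define k where "k = nat (\<lceil>B\<rceil> - 1)"
    have k: "B - 1 \<le> real k" "real k < B"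
      using B(1) unfolding k_def by linarith+
    show "real (nat \<lfloor>A\<rfloor>) * \<mu> \<le> \<gamma> / (1 + \<epsilon>) \<or> real (nat \<lfloor>A\<rfloor>) < \<gamma>"
      using A mult_right_mono[of "real (nat \<lfloor>A\<rfloor>)" A \<mu>] \<open>0 < \<mu>\<close> by simp
    \<comment> \<open>Rounding \<open>B\<close> down loses at most one sample, of mean
      \<open>\<mu>\<close>; since \<open>(1 - \<epsilon>) * \<mu> \<le> 1\<close>, the slack in
      \<open>gap\<close> absorbs it.\<close>
    have "(\<gamma> - 1) / (1 - \<epsilon>) \<le> (\<gamma> - (1 - \<epsilon>) * \<mu>) / (1 - \<epsilon>)"
      using assms pos mult_mono[of "1 - \<epsilon>" 1 \<mu> 1] by (intro divide_right_mono) auto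
    also have "\<dots> = \<gamma> / (1 - \<epsilon>) - \<mu>"
      using pos(3) by (simp add: diff_divide_distrib)
    also have "\<dots> = (B - 1) * \<mu>"
      using B(2) by (simp only: left_diff_distrib mult_1)
    also have "\<dots> \<le> real k * \<mu>"
      using k(1) \<open>0 < \<mu>\<close> by (intro mult_right_mono) auto
    finally show "\<gamma> * (1 + \<epsilon>) \<le> real k * \<mu>"
      using gap by linarith
    fix n assume n: "nat \<lfloor>A\<rfloor> < n" "n \<le> k"
    have "A < real n" "real n < B"
      using n k A(1) by linarith+
    moreover have "0 < real n"
      using n(1) by simp
    ultimately show "\<bar>(\<gamma> / real n - \<mu>) / \<mu>\<bar> < \<epsilon>"
      using assms(2,3,7) unfolding A_def B_def by (subst relative_error_less_iff) simp_all
  qed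

  have hat: "measure M {\<omega> \<in> space M. \<bar>((\<gamma> - 1) / (real (stopping_index X \<gamma> \<omega>) - 1) - \<mu>) / \<mu>\<bar> < \<epsilon>}
      > 1 - \<delta>"
  proof (rule window)
    define A where "A = (\<gamma> - 1) / ((1 + \<epsilon>) * \<mu>)"
    define B where "B = (\<gamma> - 1) / ((1 - \<epsilon>) * \<mu>)"
    have A: "0 < A" "A * \<mu> = (\<gamma> - 1) / (1 + \<epsilon>)" and B: "0 < B" "B * \<mu> = (\<gamma> - 1) / (1 - \<epsilon>)"
      using assms pos by (simp_all add: A_def B_def)
    \<comment> \<open>Here \<open>n - 1\<close> must lie between \<open>A\<close> and
      \<open>B\<close>, so both ends shift by one compared with the first estimator.\<close>
    define N where "N = Suc (nat \<lfloor>A\<rfloor>)"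
    define k where "k = nat \<lceil>B\<rceil>"
    have N: "real N \<le> A + 1" "A < real N" and k: "B \<le> real k" "real k < B + 1"
      using A(1) B(1) unfolding N_def k_def by linarith+
    show "real N * \<mu> \<le> \<gamma> / (1 + \<epsilon>) \<or> real N < \<gamma>"
    \<comment> \<open>The shift adds up to \<open>\<mu>\<close> to \<open>A * \<mu>\<close>. This
      fits if \<open>\<mu> \<le> 1 / (1 + \<epsilon>)\<close>; otherwise
      \<open>A < \<gamma> - 1\<close>, so \<open>N < \<gamma>\<close>.\<close>
    proof (cases "(1 + \<epsilon>) * \<mu> \<le> 1")
      case True
      have "real N * \<mu> \<le> (A + 1) * \<mu>"
        using N \<open>0 < \<mu>\<close> by (intro mult_right_mono) auto
      also have "\<dots> = (\<gamma> - 1) / (1 + \<epsilon>) + \<mu>"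
        using A(2) by (simp add: algebra_simps)
      also have "\<dots> \<le> (\<gamma> - 1) / (1 + \<epsilon>) + 1 / (1 + \<epsilon>)"
        using True \<open>0 < \<epsilon>\<close> by (simp add: le_divide_eq mult.commute)
      also have "\<dots> = \<gamma> / (1 + \<epsilon>)"
        by (simp add: diff_divide_distrib)
      finally show ?thesis ..
    next
      case False
      then have "A < \<gamma> - 1"
        using pos(1) \<open>\<gamma> > 1\<close> by (simp add: A_def divide_less_eq)
      with N(1) show ?thesis
        by simp
    qed
    have "B * \<mu> \<le> real k * \<mu>"
      using k(1) \<open>0 < \<mu>\<close> by (intro mult_right_mono) auto
    with B(2) gap show "\<gamma> * (1 + \<epsilon>) \<le> real k * \<mu>"
      by linarith
    fix n assume n: "N < n" "n \<le> k"
    have "A < real n - 1" "real n - 1 < B" "0 < real n - 1"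
      using n N k A(1) by linarith+
    then show "\<bar>((\<gamma> - 1) / (real n - 1) - \<mu>) / \<mu>\<bar> < \<epsilon>"
      using assms(2,3,7) unfolding A_def B_def by (subst relative_error_less_iff) simp_all
  qed
  show ?thesis
    using tilde hat unfolding mu_tilde_def mu_hat_def ..
qed

end
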